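(* Let $f:\mathbb{R}^d\to[0,\infty)$ be a nonnegative function for which there exists an open and bounded set $\Omega\subset(0,1)^d$ with Lipschitz boundary such that $f|_\Omega$ is Lipschitz and $\operatorname{supp}(f)\subset\overline{\Omega}$. Let $U:[0,\infty)^d\to\mathbb{R}$ be the unique Pareto-monotone viscosity solution of $$U_{x_1}\cdots U_{x_d}=f \ \text{ on } (0,\infty)^d,\qquad U=0\ \text{ on } \partial\big((0,\infty)^d\big),$$ satisfying the additional condition $U(x)=U(\min(x_1,1),\dots,\min(x_d,1))$ for all $x\in[0,\infty)^d$. For every $h>0$ let $U_h:[0,\infty)^d\to\mathbb{R}$ be the Pareto-monotone numerical solution defined as follows. On the grid $h\mathbb{N}_0^d$, $U_h(x)=0$ if some coordinate of $x$ is $0$, and if all coordinates of $x\in h\mathbb{N}_0^d$ are positive, $U_h(x)$ is the unique real number satisfying $U_h(x)\ge\max_{1\le i\le d}U_h(x-he_i)$ and $$\prod_{i=1}^d\big(U_h(x)-U_h(x-he_i)\big)=h^d f(x);$$ $U_h$ is extended to $[0,\infty)^d$ by $U_h(x)=U_h(\lfloor x\rfloor_h)$. Then $U_h\to U$ uniformly on $[0,\infty)^d$ as $h\to0$.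
   Context: $e_1,\dots,e_d$ are the standard basis vectors of $\mathbb{R}^d$ and $\mathbb{N}_0=\{0,1,2,\dots\}$. For $x\in\mathbb{R}^d$ and $h>0$, $\lfloor x\rfloor_h$ is the unique $y\in h\mathbb{Z}^d$ with $x-y\in[0,h)^d$. Write $x\leqq y$ if $x_i\le y_i$ for all $i$. A function $u:D\subset\mathbb{R}^d\to\mathbb{R}$ is Pareto-monotone if $x\leqq y$ implies $u(x)\le u(y)$ for all $x,y\in D$. Viscosity solutions are understood in the standard sense for a possibly discontinuous right-hand side. Let $f^*$ and $f_*$ be the upper and lower semicontinuous envelopes of $f$. A continuous function $u:[0,\infty)^d\to\mathbb{R}$ is a viscosity solution of $u_{x_1}\cdots u_{x_d}=f$ on $(0,\infty)^d$ if for every $x\in(0,\infty)^d$ and every $C^1$ function $\varphi$: (i) if $u-\varphi$ has a local maximum at $x$, then $\varphi_{x_1}(x)\cdots\varphi_{x_d}(x)\le f^*(x)$; and (ii) if $u-\varphi$ has a local minimum at $x$, then $\varphi_{x_1}(x)\cdots\varphi_{x_d}(x)\ge f_*(x)$. The boundary condition holds pointwise. Existence and uniqueness of the Pareto-monotone viscosity solution $U$ with the stated additional condition is quoted from earlier work of the same authors under the stated hypotheses on $f$.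
   Formalization: The formal theorem also assumes that the upper semicontinuous envelope of f is finite everywhere (f is locally bounded above, including on the boundary of Ω), without which the claim can fail; uniqueness of U, quoted in the text, is a hypothesis. *)

theory Defs
  imports "HOL-Analysis.Analysis"
begin

definition closed_orthant :: "(real^'n) set" where
  "closed_orthant = {x. \<forall>i. 0 \<le> x $ i}"

definition open_orthant :: "(real^'n) set" where
  "open_orthant = {x. \<forall>i. 0 < x $ i}"

text \<open>The library order on \<open>real^'n\<close> is componentwise, so Pareto-monotonicity on \<open>D\<close>
  is \<^term>\<open>mono_on D u\<close>.\<close>

text \<open>Near each boundary point, \<open>\<Omega>\<close> is the strict epigraph, in some direction \<open>\<nu>\<close>, of a
  Lipschitz function \<open>\<gamma>\<close> on the hyperplane orthogonal to \<open>\<nu>\<close>.\<close>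

definition lipschitz_boundary :: "(real^'n) set \<Rightarrow> bool" where
  "lipschitz_boundary \<Omega> \<longleftrightarrow>
    (\<forall>p \<in> frontier \<Omega>. \<exists>r>0. \<exists>\<nu> \<gamma> L. norm \<nu> = 1 \<and> L-lipschitz_on {y. y \<bullet> \<nu> = 0} \<gamma> \<and>
      \<Omega> \<inter> ball p r = {x \<in> ball p r. \<gamma> (x - (x \<bullet> \<nu>) *\<^sub>R \<nu>) < x \<bullet> \<nu>})"

text \<open>Semicontinuous envelopes. The filter \<^term>\<open>nhds x\<close> includes the point \<open>x\<close> itself.\<close>

definition usc_envelope :: "(real^'n \<Rightarrow> real) \<Rightarrow> real^'n \<Rightarrow> ereal" where
  "usc_envelope f x = Limsup (nhds x) (\<lambda>y. ereal (f y))"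

definition lsc_envelope :: "(real^'n \<Rightarrow> real) \<Rightarrow> real^'n \<Rightarrow> ereal" where
  "lsc_envelope f x = Liminf (nhds x) (\<lambda>y. ereal (f y))"

definition partial_deriv :: "'n \<Rightarrow> (real^'n \<Rightarrow> real) \<Rightarrow> real^'n \<Rightarrow> real" where
  "partial_deriv i \<phi> x = frechet_derivative \<phi> (at x) (axis i 1)"

definition C1_function :: "(real^'n \<Rightarrow> real) \<Rightarrow> bool" where
  "C1_function \<phi> \<longleftrightarrow>
    (\<forall>x. \<phi> differentiable (at x)) \<and> (\<forall>i. continuous_on UNIV (partial_deriv i \<phi>))"

definition viscosity_solution :: "(real^'n \<Rightarrow> real) \<Rightarrow> (real^'n \<Rightarrow> real) \<Rightarrow> bool" where
  "viscosity_solution f u \<longleftrightarrow>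
    continuous_on closed_orthant u \<and>
    (\<forall>x \<in> open_orthant. \<forall>\<phi>. C1_function \<phi> \<longrightarrow>
      ((\<forall>\<^sub>F y in nhds x. u y - \<phi> y \<le> u x - \<phi> x) \<longrightarrow>
        ereal (\<Prod>i\<in>UNIV. partial_deriv i \<phi> x) \<le> usc_envelope f x) \<and>
      ((\<forall>\<^sub>F y in nhds x. u x - \<phi> x \<le> u y - \<phi> y) \<longrightarrow>
        lsc_envelope f x \<le> ereal (\<Prod>i\<in>UNIV. partial_deriv i \<phi> x)))"

definition pareto_solution :: "(real^'n \<Rightarrow> real) \<Rightarrow> (real^'n \<Rightarrow> real) \<Rightarrow> bool" where
  "pareto_solution f u \<longleftrightarrow>
    mono_on closed_orthant u \<and>
    viscosity_solution f u \<and>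
    (\<forall>x \<in> frontier open_orthant. u x = 0) \<and>
    (\<forall>x \<in> closed_orthant. u x = u (\<chi> i. min (x $ i) 1))"

definition floor_grid :: "real \<Rightarrow> real^'n \<Rightarrow> real^'n" where
  "floor_grid h x =
    (THE y. (\<forall>i. \<exists>k::int. y $ i = h * of_int k) \<and> (\<forall>i. (x - y) $ i \<in> {0..<h}))"

lemma floor_grid_eq:
  assumes "h > 0"
  shows "floor_grid h x = (\<chi> i. h * of_int \<lfloor>x $ i / h\<rfloor>)"
  unfolding floor_grid_def
proof (rule the_equality)
  have "h * of_int \<lfloor>x $ i / h\<rfloor> \<le> x $ i \<and> x $ i < h + h * of_int \<lfloor>x $ i / h\<rfloor>" for i
    using floor_divide_lower[OF assms, of "x $ i"] floor_divide_upper[OF assms, of "x $ i"]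
    by (simp add: algebra_simps)
  then show "(\<forall>i. \<exists>k::int. (\<chi> i. h * of_int \<lfloor>x $ i / h\<rfloor>) $ i = h * of_int k) \<and>
      (\<forall>i. (x - (\<chi> i. h * of_int \<lfloor>x $ i / h\<rfloor>)) $ i \<in> {0..<h})"
    by (auto simp: algebra_simps)
next
  fix y
  assume y: "(\<forall>i. \<exists>k::int. y $ i = h * of_int k) \<and> (\<forall>i. (x - y) $ i \<in> {0..<h})"
  have "y $ i = h * of_int \<lfloor>x $ i / h\<rfloor>" for i
  proof -
    obtain k :: int where k: "y $ i = h * of_int k"
      using y by blast
    have "0 \<le> x $ i - h * of_int k" "x $ i - h * of_int k < h"
      using y k by (metis atLeastLessThan_iff vector_minus_component)+
    then have "of_int k \<le> x $ i / h" "x $ i / h < of_int k + 1"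
      using assms by (simp_all add: field_simps)
    then have "\<lfloor>x $ i / h\<rfloor> = k"
      by (simp add: floor_eq_iff)
    with k show ?thesis by simp
  qed
  then show "y = (\<chi> i. h * of_int \<lfloor>x $ i / h\<rfloor>)"
    by (simp add: vec_eq_iff)
qed

text \<open>For \<open>h > 0\<close> and \<open>f \<ge> 0\<close> the conditions below determine the values of \<open>v\<close> on
  \<^term>\<open>closed_orthant\<close>: given the values at the points \<open>x - h e\<^sub>i\<close>, the product is strictly
  increasing in \<open>v x\<close> from \<open>0\<close> to infinity on the half-line above their maximum.\<close>

definition numerical_solution ::
    "(real^'n \<Rightarrow> real) \<Rightarrow> real \<Rightarrow> (real^'n \<Rightarrow> real) \<Rightarrow> bool" where
  "numerical_solution f h v \<longleftrightarrow>
    (\<forall>x. (\<forall>i. \<exists>k::nat. x $ i = h * real k) \<longrightarrow>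
      (if \<exists>i. x $ i = 0 then v x = 0
       else (MAX i. v (x - h *\<^sub>R axis i 1)) \<le> v x \<and>
         (\<Prod>i\<in>UNIV. v x - v (x - h *\<^sub>R axis i 1)) = h ^ CARD('n) * f x)) \<and>
    (\<forall>x \<in> closed_orthant. v x = v (floor_grid h x))"

end

theory Submission
  imports Defs "HOL-Complex_Analysis.Great_Picard"
begin

text \<open>
  Let \<open>f \<le> M\<close>. The geometric mean \<open>d (M (x\<^sub>i - a) \<Prod>\<^bsub>j \<noteq> i\<^esub> x\<^sub>j)\<^bsup>1/d\<^esup>\<close> is a supersolution of the scheme on
  \<open>{x\<^sub>i > a}\<close> and remains one after adding the monotone function \<open>U\<^sub>h(x\<^sub>1, \<dots>, a, \<dots>, x\<^sub>d)\<close>. Discrete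
  comparison therefore bounds the growth of \<open>U\<^sub>h\<close> by a modulus of order \<open>1/d\<close>, up to an error
  \<open>h\<^bsup>1/d\<^esup>\<close> caused by rounding to the grid. So every sequence \<open>h\<^sub>n \<rightarrow> 0\<close> has a subsequence along
  which \<open>U\<^sub>h\<close> converges uniformly to a continuous function. The scheme is monotone and consistent,
  so each such limit is a Pareto-monotone viscosity solution with the required boundary values
  and truncation property; by uniqueness it is \<open>U\<close>.
\<close>

section \<open>The discrete scheme\<close>

lemma root_one_minus_le:
  fixes t :: real
  assumes "0 < n" "t \<le> 1"
  shows "root n (1 - t) \<le> 1 - t / real n"
proof -
  have n: "1 \<le> real n"
    using assms by simp
  have t: "t / real n \<le> 1"
    using assms n by (simp add: divide_le_eq)
  have "1 - t \<le> (1 - t / real n) ^ n"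
    using Bernoulli_inequality[of "- (t / real n)" n] t assms(1) by simp
  then have "root n (1 - t) \<le> root n ((1 - t / real n) ^ n)"
    using assms by simp
  also have "\<dots> = 1 - t / real n"
    using assms t by (simp add: real_root_power_cancel)
  finally show ?thesis .
qed

text \<open>Reduces to superadditivity of the power, \<open>x ^ m + y ^ m \<le> (x + y) ^ m\<close>.
  It later splits the rounding error \<open>h\<close> off from the distance of two points.\<close>

lemma root_add_le:
  fixes a b :: real
  assumes "0 < n" "0 \<le> a" "0 \<le> b"
  shows "root n (a + b) \<le> root n a + root n b"
proof -
  have "a + b = root n a ^ n + root n b ^ n"
    using assms by simp
  also have "\<dots> \<le> (root n a + root n b) ^ n"
  proof -
    have *: "x ^ m + y ^ m \<le> (x + y) ^ m" if "0 \<le> x" "0 \<le> y" "0 < m" for x y :: real and m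
      using that(3)
    proof (induction m rule: nat_induct_non_zero)
      case (Suc m)
      have "x ^ Suc m + y ^ Suc m \<le> (x + y) * (x ^ m + y ^ m)"
        using that by (simp add: algebra_simps)
      also have "\<dots> \<le> (x + y) * (x + y) ^ m"
        using that Suc by (intro mult_left_mono) auto
      finally show ?case by simp
    qed simp
    show ?thesis
      using assms by (intro *) auto
  qed
  finally have "root n (a + b) \<le> root n ((root n a + root n b) ^ n)"
    using assms by simp
  then show ?thesis
    using assms by (simp add: real_root_power_cancel)
qed

text \<open>On positive real \<open>p\<close> this is a classical solution of the equation with
  right-hand side 1: its partial derivative in direction \<open>i\<close> is the geometric mean
  divided by \<open>p i\<close>, and these multiply to 1.\<close>

definition gmean_weight :: "('n::finite \<Rightarrow> real) \<Rightarrow> real" where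
  "gmean_weight p = real CARD('n) * root CARD('n) (\<Prod>i\<in>UNIV. p i)"

text \<open>Concavity in the single variable \<open>p j\<close>: the left-hand side is the partial
  derivative of \<open>gmean_weight\<close> at \<open>p\<close>, and a backward difference of a
  concave function dominates the derivative at its right end. The condition
  \<open>1 \<le> p j\<close> keeps the decremented product nonnegative.\<close>

lemma gmean_weight_decrement:
  fixes p :: "'n::finite \<Rightarrow> real"
  assumes pos: "\<And>i. 0 < p i" and j: "1 \<le> p j"
  shows "root CARD('n) (\<Prod>i\<in>UNIV. p i) / p j \<le> gmean_weight p - gmean_weight (p(j := p j - 1))"
proof -
  let ?n = "CARD('n)" and ?P = "\<Prod>i\<in>UNIV. p i"
  have "(\<Prod>i\<in>UNIV. (p(j := p j - 1)) i) = (p j - 1) * (\<Prod>i\<in>UNIV - {j}. p i)"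
    by (subst prod.remove[of _ j]) auto
  also have "\<dots> = ?P * (1 - 1 / p j)"
    using pos[of j] by (subst prod.remove[of _ j]) (auto simp: field_simps)
  finally have eq: "(\<Prod>i\<in>UNIV. (p(j := p j - 1)) i) = ?P * (1 - 1 / p j)" .
  have "root ?n (1 - 1 / p j) \<le> 1 - (1 / p j) / real ?n"
    using j by (intro root_one_minus_le) auto
  then have "root ?n ?P * root ?n (1 - 1 / p j) \<le> root ?n ?P * (1 - (1 / p j) / real ?n)"
    using pos by (intro mult_left_mono) (simp_all add: prod_pos less_imp_le)
  then have "real ?n * (root ?n ?P * root ?n (1 - 1 / p j))
      \<le> real ?n * (root ?n ?P * (1 - (1 / p j) / real ?n))"
    by (rule mult_left_mono) simp
  moreover have "real ?n * (root ?n ?P * (1 - (1 / p j) / real ?n))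
      = real ?n * root ?n ?P - root ?n ?P / p j"
    by (simp add: field_simps)
  ultimately show ?thesis
    unfolding gmean_weight_def eq real_root_mult by linarith
qed

section \<open>Solutions of the scheme in index form\<close>

lemma sum_upd_less:
  fixes k :: "'n::finite \<Rightarrow> nat"
  assumes "0 < k i"
  shows "sum (k(i := k i - 1)) UNIV < sum k UNIV"
  using assms by (intro sum_strict_mono_ex1) auto

text \<open>The grid width is scaled out: \<open>k\<close> stands for the grid point with
  coordinates \<open>h * k i\<close>, and \<open>g\<close> absorbs the factor
  \<open>h ^ CARD('n)\<close>.\<close>

locale grid_scheme =
  fixes U g :: "('n::finite \<Rightarrow> nat) \<Rightarrow> real"
  assumes zero: "\<And>k i. k i = 0 \<Longrightarrow> U k = 0"
    and step: "\<And>k i. (\<And>j. 0 < k j) \<Longrightarrow> U (k(i := k i - 1)) \<le> U k"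
    and prod_eq: "\<And>k. (\<And>j. 0 < k j) \<Longrightarrow> (\<Prod>i\<in>UNIV. U k - U (k(i := k i - 1))) = g k"
begin

lemma step': "U (k(i := k i - 1)) \<le> U k"
proof (cases "\<forall>j. 0 < k j")
  case True
  then show ?thesis using step by blast
next
  case False
  then obtain j where j: "k j = 0" by blast
  \<comment> \<open>Truncated subtraction gives \<open>0 - 1 = 0\<close>, so the predecessor stays
    on the boundary even if \<open>i = j\<close>.\<close>
  then have "(k(i := k i - 1)) j = 0" by auto
  then show ?thesis using zero j by (metis order_refl)
qed

lemma mono: "k \<le> l \<Longrightarrow> U k \<le> U l"
proof (induction "sum l UNIV" arbitrary: l rule: less_induct)
  case less
  show ?case
  proof (cases "k = l")
    case False
    then obtain j where j: "k j < l j"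
      using less.prems by (metis le_funE le_neq_implies_less ext)
    have "U k \<le> U (l(j := l j - 1))"
      using less.prems j by (intro less.hyps sum_upd_less) (auto simp: le_fun_def)
    then show ?thesis
      using step'[of l j] by simp
  qed simp
qed

lemma nonneg: "0 \<le> U k"
  using mono[of "\<lambda>_. 0" k] zero[of "\<lambda>_. 0"] by (simp add: le_fun_def)

text \<open>Where \<open>g\<close> vanishes, so does one increment, and the value at
  \<open>k\<close> is already attained at a predecessor. Descending in this way ends either on the
  boundary or in the box of side \<open>N\<close>.\<close>

lemma truncate:
  assumes g: "\<And>k i. N < k i \<Longrightarrow> g k = 0"
  shows "U k = U (\<lambda>i. min (k i) N)"
proof (rule antisym)
  show "U k \<le> U (\<lambda>i. min (k i) N)"
  proof (induction "sum k UNIV" arbitrary: k rule: less_induct)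
    case less
    show ?case
    proof (cases "(\<exists>j. k j = 0) \<or> (\<forall>i. k i \<le> N)")
      case True
      then show ?thesis
      proof
        assume "\<exists>j. k j = 0"
        then show ?thesis using zero nonneg by metis
      next
        assume "\<forall>i. k i \<le> N"
        then have "(\<lambda>i. min (k i) N) = k" by auto
        then show ?thesis by simp
      qed
    next
      case False
      then have pos: "\<And>j. 0 < k j" and "g k = 0"
        using g by (auto simp: not_le)
      \<comment> \<open>The coordinate \<open>j\<close> need not be one that exceeds
        \<open>N\<close>; monotonicity after the induction hypothesis covers that case.\<close>
      then obtain j where j: "U k = U (k(j := k j - 1))"
        using prod_eq[of k] by auto
      also have "\<dots> \<le> U (\<lambda>i. min ((k(j := k j - 1)) i) N)"
        using pos by (intro less.hyps sum_upd_less)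
      also have "\<dots> \<le> U (\<lambda>i. min (k i) N)"
        by (intro mono) (auto simp: le_fun_def)
      finally show ?thesis .
    qed
  qed
qed (auto intro!: mono simp: le_fun_def)

(* The barrier U(k(i := a)) + gmean_weight is a supersolution on {k i > a}: its increments
   dominate those of gmean_weight, and the geometric mean solves the scheme with constant
   right-hand side up to a favourable sign. *)
lemma upd_bound:
  assumes g: "\<And>k. g k \<le> G" and G: "0 \<le> G" and a: "a \<le> k i"
  shows "U k \<le> U (k(i := a)) +
    root CARD('n) G * gmean_weight (\<lambda>j. if j = i then real (k i) - real a else real (k j))"
  using a
proof (induction "sum k UNIV" arbitrary: k rule: less_induct)
  case less
  let ?n = "CARD('n)"
  define p where "p l = (\<lambda>j. if j = i then real (l i) - real a else real (l j))" for l :: "'n \<Rightarrow> nat"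
  define W where "W l = U (l(i := a)) + root ?n G * gmean_weight (p l)" for l
  have p_nonneg: "0 \<le> p l j" if "a \<le> l i" for l j
    using that by (auto simp: p_def)
  have W_ge: "U (l(i := a)) \<le> W l" if "a \<le> l i" for l
    unfolding W_def gmean_weight_def
    using G p_nonneg[of l, OF that] by (simp add: prod_nonneg)
  have "U k \<le> W k"
  proof (cases "(\<exists>j. k j = 0) \<or> k i = a")
    case True
    then show ?thesis
    proof
      assume "\<exists>j. k j = 0"
      then have "U k = 0" using zero by blast
      then show ?thesis using nonneg[of "k(i := a)"] W_ge[of k, OF less.prems] by linarith
    next
      assume "k i = a"
      then have "k(i := a) = k" by auto
      then show ?thesis using W_ge[of k, OF less.prems] by simp
    qed
  next
    case False
    then have pos: "\<And>j. 0 < k j" and ai: "a < k i"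
      using less.prems by auto
    have p1: "1 \<le> p k j" for j
      using pos[of j] ai by (auto simp: p_def)
    then have p_pos: "0 < p k j" for j
      using less_le_trans zero_less_one by blast
    define \<rho> where "\<rho> = root ?n (\<Prod>j\<in>UNIV. p k j)"
    have \<rho>: "0 < \<rho>"
      unfolding \<rho>_def using p_pos by (simp add: prod_pos)
    \<comment> \<open>The first term of \<open>W\<close> is monotone, so its contribution to the
      difference is nonnegative; what remains is the decrement of the geometric mean.\<close>
    have W_step: "root ?n G * (\<rho> / p k j) \<le> W k - W (k(j := k j - 1))" for j
    proof -
      have "p (k(j := k j - 1)) = (p k)(j := p k j - 1)"
        using pos[of j] ai by (auto simp: p_def fun_eq_iff of_nat_diff)
      moreover have "U ((k(j := k j - 1))(i := a)) \<le> U (k(i := a))"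
        by (intro mono) (auto simp: le_fun_def)
      moreover have "root ?n G * (\<rho> / p k j)
          \<le> root ?n G * (gmean_weight (p k) - gmean_weight ((p k)(j := p k j - 1)))"
        unfolding \<rho>_def using G p1 p_pos by (intro mult_left_mono gmean_weight_decrement) auto
      ultimately show ?thesis
        by (simp add: W_def algebra_simps)
    qed
    have IH: "U (k(j := k j - 1)) \<le> W (k(j := k j - 1))" for j
    proof -
      have "a \<le> (k(j := k j - 1)) i" using ai by auto
      from less.hyps[OF sum_upd_less[OF pos] this] show ?thesis
        unfolding W_def p_def .
    qed
    show ?thesis
    \<comment> \<open>Discrete comparison: with \<open>U \<le> W\<close> at all predecessors and
      \<open>U k > W k\<close>, every increment of \<open>U\<close> exceeds that of
      \<open>W\<close>, so their product exceeds \<open>G\<close>.\<close>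
    proof (rule ccontr)
      assume "\<not> U k \<le> W k"
      then have lt: "W k - W (k(j := k j - 1)) < U k - U (k(j := k j - 1))" for j
        using IH[of j] by linarith
      have nn: "0 \<le> root ?n G * (\<rho> / p k j)" for j
        using G \<rho> p_pos[of j] by simp
      have "(\<Prod>j\<in>UNIV. root ?n G * (\<rho> / p k j)) < (\<Prod>j\<in>UNIV. U k - U (k(j := k j - 1)))"
      \<comment> \<open>Strictness is required at one factor only; \<open>undefined\<close> merely
        names a coordinate.\<close>
      proof (rule prod_mono_strict[of undefined])
        show "0 \<le> root ?n G * (\<rho> / p k j) \<and> root ?n G * (\<rho> / p k j) \<le> U k - U (k(j := k j - 1))"
          for j using nn[of j] W_step[of j] lt[of j] by linarith
        show "0 < U k - U (k(j := k j - 1))" for j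
          using nn[of j] W_step[of j] lt[of j] by linarith
        show "root ?n G * (\<rho> / p k undefined) < U k - U (k(undefined := k undefined - 1))"
          using W_step[of undefined] lt[of undefined] by linarith
      qed auto
      moreover have "(\<Prod>j\<in>UNIV. root ?n G * (\<rho> / p k j)) = G"
      proof -
        \<comment> \<open>The lower bounds multiply to exactly \<open>G\<close>, because this power
          of the geometric mean cancels the denominators.\<close>
        have "(\<Prod>j\<in>UNIV. p k j) = \<rho> ^ ?n"
          unfolding \<rho>_def using p_pos by (simp add: prod_nonneg less_imp_le)
        moreover have "root ?n G ^ ?n = G"
          using G by simp
        ultimately show ?thesis
          using \<rho> by (simp add: prod.distrib prod_dividef power_mult_distrib)
      qed
      ultimately show False
        using prod_eq[of k] pos g[of k] by simp
    qed
  qed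
  then show ?case
    unfolding W_def p_def .
qed

end

section \<open>The scheme on the grid of width h\<close>

definition grid_point :: "real \<Rightarrow> ('n::finite \<Rightarrow> nat) \<Rightarrow> real^'n" where
  "grid_point h k = (\<chi> i. h * real (k i))"

lemma grid_point_nth [simp]: "grid_point h k $ i = h * real (k i)"
  by (simp add: grid_point_def)

lemma grid_point_minus_axis:
  assumes "0 < k i"
  shows "grid_point h k - h *\<^sub>R axis i 1 = grid_point h (k(i := k i - 1))"
  using assms by (auto simp: vec_eq_iff axis_def of_nat_diff algebra_simps)

definition grid_index :: "real \<Rightarrow> real^'n \<Rightarrow> 'n \<Rightarrow> nat" where
  "grid_index h x = (\<lambda>i. nat \<lfloor>x $ i / h\<rfloor>)"

lemma floor_grid_grid_index:
  assumes "0 < h" "x \<in> closed_orthant"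
  shows "floor_grid h x = grid_point h (grid_index h x)"
  using assms by (auto simp: floor_grid_eq grid_index_def vec_eq_iff closed_orthant_def)

lemma grid_index_mono:
  assumes "0 < h" "x \<le> y"
  shows "grid_index h x \<le> grid_index h y"
  using assms
  by (auto simp: grid_index_def le_fun_def less_eq_vec_def intro!: nat_mono floor_mono divide_right_mono)

lemma grid_index_bounds:
  assumes "0 < h" "x \<in> closed_orthant"
  shows "h * real (grid_index h x i) \<le> x $ i" "x $ i < h * real (grid_index h x i) + h"
proof -
  have nn: "0 \<le> x $ i / h"
    using assms by (auto simp: closed_orthant_def)
  then have eq: "real (grid_index h x i) = of_int \<lfloor>x $ i / h\<rfloor>"
    unfolding grid_index_def by simp
  show "h * real (grid_index h x i) \<le> x $ i"
    unfolding eq using floor_divide_lower[OF assms(1), of "x $ i"] by (simp add: mult.commute)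
  show "x $ i < h * real (grid_index h x i) + h"
    unfolding eq using floor_divide_upper[OF assms(1), of "x $ i"] by (simp add: algebra_simps)
qed

text \<open>\<open>M\<close> is a parameter independent of \<open>h\<close>, so that the estimates
  are uniform along a sequence of grid widths. The vanishing of \<open>f\<close> beyond the unit
  cube gives the truncation property.\<close>

locale numerical =
  fixes f :: "real^'n \<Rightarrow> real" and h :: real and v :: "real^'n \<Rightarrow> real" and M :: real
  assumes h: "0 < h"
    and v: "numerical_solution f h v"
    and f_le: "\<And>x. f x \<le> M"
    and f_zero: "\<And>x i. 1 < x $ i \<Longrightarrow> f x = 0"
begin

lemma M_nonneg: "0 \<le> M"
  using f_le[of "\<chi> i. 2"] f_zero[of "\<chi> i. 2"] by simp

lemma on_grid:
  shows "k i = 0 \<Longrightarrow> v (grid_point h k) = 0"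
    and "(\<And>j. 0 < k j) \<Longrightarrow> v (grid_point h (k(i := k i - 1))) \<le> v (grid_point h k)"
    and "(\<And>j. 0 < k j) \<Longrightarrow>
      (\<Prod>i\<in>UNIV. v (grid_point h k) - v (grid_point h (k(i := k i - 1)))) = h ^ CARD('n) * f (grid_point h k)"
proof -
  have ex: "\<forall>i. \<exists>m::nat. grid_point h k $ i = h * real m"
    by auto
  have *: "if \<exists>i. grid_point h k $ i = 0 then v (grid_point h k) = 0
       else (MAX i. v (grid_point h k - h *\<^sub>R axis i 1)) \<le> v (grid_point h k) \<and>
         (\<Prod>i\<in>UNIV. v (grid_point h k) - v (grid_point h k - h *\<^sub>R axis i 1))
            = h ^ CARD('n) * f (grid_point h k)"
    using v ex unfolding numerical_solution_def by blast
  show "v (grid_point h k) = 0" if "k i = 0"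
    using * that by (metis grid_point_nth mult_zero_right of_nat_0)
  assume pos: "\<And>j. 0 < k j"
  then have "\<not> (\<exists>i. grid_point h k $ i = 0)"
    using h by auto
  then have max: "(MAX i. v (grid_point h k - h *\<^sub>R axis i 1)) \<le> v (grid_point h k)"
    and prod: "(\<Prod>i\<in>UNIV. v (grid_point h k) - v (grid_point h k - h *\<^sub>R axis i 1))
            = h ^ CARD('n) * f (grid_point h k)"
    using * by meson+
  show "v (grid_point h (k(i := k i - 1))) \<le> v (grid_point h k)"
  proof -
    have "v (grid_point h k - h *\<^sub>R axis i 1) \<le> (MAX i. v (grid_point h k - h *\<^sub>R axis i 1))"
      by (intro Max_ge) auto
    then show ?thesis
      using max pos by (simp add: grid_point_minus_axis)
  qed
  show "(\<Prod>i\<in>UNIV. v (grid_point h k) - v (grid_point h (k(i := k i - 1)))) = h ^ CARD('n) * f (grid_point h k)"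
    using prod pos by (simp add: grid_point_minus_axis)
qed

sublocale grid_scheme "\<lambda>k. v (grid_point h k)" "\<lambda>k. h ^ CARD('n) * f (grid_point h k)"
  by unfold_locales (use on_grid in auto)

lemma v_eq: "x \<in> closed_orthant \<Longrightarrow> v x = v (grid_point h (grid_index h x))"
  using v h floor_grid_grid_index unfolding numerical_solution_def by metis

lemma v_zero: "x \<in> closed_orthant \<Longrightarrow> x $ i = 0 \<Longrightarrow> v x = 0"
  using v_eq[of x] zero[of "grid_index h x" i] by (simp add: grid_index_def)

lemma v_mono: "x \<in> closed_orthant \<Longrightarrow> y \<in> closed_orthant \<Longrightarrow> x \<le> y \<Longrightarrow> v x \<le> v y"
  using mono[OF grid_index_mono[OF h]] v_eq by metis

lemma v_nonneg: "x \<in> closed_orthant \<Longrightarrow> 0 \<le> v x"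
  using nonneg v_eq by metis

text \<open>Rounding down commutes with truncation at 1, which turns the claim into
  \<open>truncate\<close> with \<open>N\<close> the index of the last grid hyperplane that does not
  pass 1.\<close>

lemma v_truncate:
  assumes "x \<in> closed_orthant"
  shows "v (\<chi> i. min (x $ i) 1) = v x"
proof -
  define N where "N = nat \<lfloor>1 / h\<rfloor>"
  have "grid_index h (\<chi> i. min (x $ i) 1) = (\<lambda>i. min (grid_index h x i) N)"
  proof
    fix i
    have "min (x $ i) 1 / h = min (x $ i / h) (1 / h)"
      using h by (simp add: min_def divide_le_cancel)
    moreover have "nat \<lfloor>min a b\<rfloor> = min (nat \<lfloor>a\<rfloor>) (nat \<lfloor>b\<rfloor>)" for a b :: real
      by (cases a b rule: linorder_cases) (auto simp: min_def nat_mono floor_mono le_antisym)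
    ultimately show "grid_index h (\<chi> i. min (x $ i) 1) i = min (grid_index h x i) N"
      by (simp add: grid_index_def N_def)
  qed
  moreover have "f (grid_point h k) = 0" if "N < k i" for k i
  proof (rule f_zero[of _ i])
    have "1 / h < real (k i)"
      using that h unfolding N_def by linarith
    then show "1 < grid_point h k $ i"
      using h by (simp add: field_simps)
  qed
  then have "v (grid_point h (grid_index h x)) = v (grid_point h (\<lambda>i. min (grid_index h x i) N))"
    by (intro truncate) simp
  moreover have "(\<chi> i. min (x $ i) 1) \<in> closed_orthant"
    using assms by (auto simp: closed_orthant_def)
  ultimately show ?thesis
    using v_eq assms by metis
qed

section \<open>Modulus of continuity, uniform in the grid width\<close>

lemma grid_upd_bound:
  assumes a: "a \<le> k i" and k: "\<And>j. h * real (k j) \<le> 1"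
  shows "v (grid_point h k) \<le> v (grid_point h (k(i := a))) +
    real CARD('n) * root CARD('n) M * root CARD('n) (h * (real (k i) - real a))"
proof -
  let ?n = "CARD('n)"
  define p where "p j = (if j = i then real (k i) - real a else real (k j))" for j
  have nn: "0 \<le> p j" for j
    using a by (auto simp: p_def)
  \<comment> \<open>The factor \<open>h ^ ?n\<close> comes from the right-hand side of the scheme
    and turns indices into coordinates.\<close>
  have "h ^ ?n * (\<Prod>j\<in>UNIV. p j) = (\<Prod>j\<in>UNIV. h * p j)"
    by (simp add: prod.distrib)
  also have "\<dots> = h * p i * (\<Prod>j\<in>UNIV - {i}. h * p j)"
    by (subst prod.remove[of _ i]) auto
  \<comment> \<open>In the unit cube all factors but the one at \<open>i\<close> are at most 1, so
    only the increase in direction \<open>i\<close> enters the bound.\<close>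
  also have "\<dots> \<le> h * p i * 1"
    using h nn[of i] k by (intro mult_left_mono prod_le_1 mult_nonneg_nonneg) (auto simp: p_def)
  finally have le: "h ^ ?n * (\<Prod>j\<in>UNIV. p j) \<le> h * (real (k i) - real a)"
    by (simp add: p_def)
  have "v (grid_point h k) \<le> v (grid_point h (k(i := a))) + root ?n (h ^ ?n * M) * gmean_weight p"
    unfolding p_def using h f_le M_nonneg a by (intro upd_bound) (auto intro: mult_left_mono)
  moreover have "root ?n (h ^ ?n * M) * gmean_weight p
      = real ?n * root ?n M * root ?n (h ^ ?n * (\<Prod>j\<in>UNIV. p j))"
    by (simp add: gmean_weight_def real_root_mult)
  moreover have "real ?n * root ?n M * root ?n (h ^ ?n * (\<Prod>j\<in>UNIV. p j))
      \<le> real ?n * root ?n M * root ?n (h * (real (k i) - real a))"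
    using le M_nonneg by (intro mult_left_mono) auto
  ultimately show ?thesis by linarith
qed

text \<open>One coordinate is raised at a time, each at the cost given by
  \<open>grid_upd_bound\<close>. The path leads from \<open>l\<close> to the maximum of
  \<open>k\<close> and \<open>l\<close>, since that bound compares only with a lower index;
  monotonicity then gives the estimate at \<open>k\<close>.\<close>

lemma grid_modulus:
  assumes k: "\<And>j. h * real (k j) \<le> 1" and l: "\<And>j. h * real (l j) \<le> 1"
    and d: "\<And>j. h * (real (k j) - real (l j)) \<le> d" and "0 \<le> d"
  shows "v (grid_point h k) \<le> v (grid_point h l) +
    real CARD('n) * (real CARD('n) * root CARD('n) M * root CARD('n) d)"
proof -
  let ?n = "CARD('n)"
  let ?C = "real ?n * root ?n M * root ?n d"
  define m where "m A = (\<lambda>j. if j \<in> A then max (k j) (l j) else l j)" for A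
  have "v (grid_point h (m A)) \<le> v (grid_point h l) + real (card A) * ?C" if "finite A" for A
    using that
  proof (induction A rule: finite_induct)
    case empty
    then show ?case by (simp add: m_def)
  next
    case (insert i A)
    have m_upd: "(m (insert i A))(i := l i) = m A"
      using insert.hyps by (auto simp: m_def)
    have "v (grid_point h (m (insert i A))) \<le> v (grid_point h ((m (insert i A))(i := l i)))
        + real ?n * root ?n M * root ?n (h * (real (m (insert i A) i) - real (l i)))"
      using k l by (intro grid_upd_bound) (auto simp: m_def max_def)
    moreover have "real ?n * root ?n M * root ?n (h * (real (m (insert i A) i) - real (l i))) \<le> ?C"
      using M_nonneg d[of i] \<open>0 \<le> d\<close> by (intro mult_left_mono) (auto simp: m_def max_def)
    moreover have "real (card (insert i A)) * ?C = real (card A) * ?C + ?C"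
      using insert.hyps by (simp add: algebra_simps)
    ultimately show ?case
      using insert.IH unfolding m_upd by linarith
  qed
  from this[of UNIV] have "v (grid_point h (m UNIV)) \<le> v (grid_point h l) + real ?n * ?C"
    by simp
  moreover have "v (grid_point h k) \<le> v (grid_point h (m UNIV))"
    by (intro mono) (auto simp: m_def le_fun_def)
  ultimately show ?thesis by linarith
qed

text \<open>One factor \<open>CARD('n)\<close> stems from \<open>gmean_weight\<close>, the other
  from the number of coordinate changes. Rounding costs less than \<open>h\<close> per coordinate,
  hence the term \<open>root CARD('n) h\<close>.\<close>

lemma v_modulus:
  assumes x: "x \<in> cbox 0 1" and y: "y \<in> cbox 0 1"
  shows "v y \<le> v x + (real CARD('n))\<^sup>2 * root CARD('n) M * (root CARD('n) (norm (x - y)) + root CARD('n) h)"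
proof -
  have orth: "x \<in> closed_orthant" "y \<in> closed_orthant"
    using x y by (auto simp: closed_orthant_def mem_box_cart)
  have le1: "x $ j \<le> 1" "y $ j \<le> 1" for j
    using x y by (auto simp: mem_box_cart)
  have grid_le1: "h * real (grid_index h x j) \<le> 1" "h * real (grid_index h y j) \<le> 1" for j
    using le1[of j] grid_index_bounds(1)[OF h orth(1), of j] grid_index_bounds(1)[OF h orth(2), of j]
    by linarith+
  define C where "C = (real CARD('n))\<^sup>2 * root CARD('n) M"
  have C: "0 \<le> C"
    using M_nonneg by (simp add: C_def)
  have d: "h * (real (grid_index h y j) - real (grid_index h x j)) \<le> norm (x - y) + h" for j
    using grid_index_bounds[OF h orth(1), of j] grid_index_bounds[OF h orth(2), of j]
      component_le_norm_cart[of "x - y" j] by (simp add: algebra_simps)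
  have "v (grid_point h (grid_index h y)) \<le> v (grid_point h (grid_index h x)) +
    real CARD('n) * (real CARD('n) * root CARD('n) M * root CARD('n) (norm (x - y) + h))"
    using grid_le1 d h by (intro grid_modulus) auto
  then have "v y \<le> v x + C * root CARD('n) (norm (x - y) + h)"
    using v_eq orth by (simp add: C_def power2_eq_square algebra_simps)
  also have "\<dots> \<le> v x + C * (root CARD('n) (norm (x - y)) + root CARD('n) h)"
    using C h by (intro add_left_mono mult_left_mono root_add_le) auto
  finally show ?thesis
    by (simp only: C_def)
qed

end

section \<open>Limits of numerical solutions\<close>

lemma partial_difference_quotient:
  fixes \<phi> :: "real^'n \<Rightarrow> real"
  assumes \<phi>: "C1_function \<phi>" and z: "z \<longlonglongrightarrow> x" and h: "h \<longlonglongrightarrow> 0" "\<And>n::nat. 0 < h n"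
  shows "(\<lambda>n. (\<phi> (z n) - \<phi> (z n - h n *\<^sub>R axis i 1)) / h n) \<longlonglongrightarrow> partial_deriv i \<phi> x"
proof -
  let ?a = "axis i 1 :: real^'n"
  have deriv: "((\<lambda>t. \<phi> (y + t *\<^sub>R ?a)) has_real_derivative partial_deriv i \<phi> (y + t *\<^sub>R ?a)) (at t)"
    for y t
  proof -
    let ?D = "frechet_derivative \<phi> (at (y + t *\<^sub>R ?a))"
    have D: "(\<phi> has_derivative ?D) (at (y + t *\<^sub>R ?a))"
      using \<phi> frechet_derivative_works unfolding C1_function_def by blast
    have "((\<lambda>t. y + t *\<^sub>R ?a) has_derivative (\<lambda>s. s *\<^sub>R ?a)) (at t)"
      by (auto intro!: derivative_eq_intros)
    from has_derivative_compose[OF this D]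
    have "((\<lambda>t. \<phi> (y + t *\<^sub>R ?a)) has_derivative (\<lambda>s. ?D (s *\<^sub>R ?a))) (at t)" .
    moreover have "?D (s *\<^sub>R ?a) = partial_deriv i \<phi> (y + t *\<^sub>R ?a) * s" for s
      using linear_scale[OF has_derivative_linear[OF D]] by (simp add: partial_deriv_def)
    ultimately show ?thesis
      by (simp add: has_field_derivative_def)
  qed
  \<comment> \<open>The mean value theorem yields an intermediate point that still tends to
    \<open>x\<close>, so continuity of the partial derivative handles the moving base point
    \<open>z n\<close>.\<close>
  have "\<exists>s. - h n < s \<and> s < 0 \<and>
      \<phi> (z n) - \<phi> (z n - h n *\<^sub>R ?a) = h n * partial_deriv i \<phi> (z n + s *\<^sub>R ?a)" for n
    using MVT2[of "- h n" 0 "\<lambda>t. \<phi> (z n + t *\<^sub>R ?a)" "\<lambda>t. partial_deriv i \<phi> (z n + t *\<^sub>R ?a)"]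
      h(2)[of n] deriv by auto
  then obtain s where s: "\<And>n. - h n < s n" "\<And>n. s n < 0"
    and eq: "\<And>n. \<phi> (z n) - \<phi> (z n - h n *\<^sub>R ?a) = h n * partial_deriv i \<phi> (z n + s n *\<^sub>R ?a)"
    by metis
  have "s \<longlonglongrightarrow> 0"
  proof (rule tendsto_sandwich)
    show "(\<lambda>n. - h n) \<longlonglongrightarrow> 0"
      using tendsto_minus[OF h(1)] by simp
  qed (use s in \<open>auto simp: less_imp_le\<close>)
  then have "(\<lambda>n. z n + s n *\<^sub>R ?a) \<longlonglongrightarrow> x + 0 *\<^sub>R ?a"
    by (intro tendsto_intros z)
  then have "(\<lambda>n. z n + s n *\<^sub>R ?a) \<longlonglongrightarrow> x"
    by simp
  moreover have "isCont (partial_deriv i \<phi>) x"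
    using \<phi> by (simp add: C1_function_def continuous_on_eq_continuous_at)
  ultimately have "(\<lambda>n. partial_deriv i \<phi> (z n + s n *\<^sub>R ?a)) \<longlonglongrightarrow> partial_deriv i \<phi> x"
    by (rule isCont_tendsto_compose[rotated])
  moreover have "(\<phi> (z n) - \<phi> (z n - h n *\<^sub>R ?a)) / h n = partial_deriv i \<phi> (z n + s n *\<^sub>R ?a)" for n
    using eq[of n] h(2)[of n] by simp
  ultimately show ?thesis by simp
qed

section \<open>Maximizers over grid points\<close>

lemma grid_index_tendsto:
  fixes x :: "real^'n"
  assumes x: "x \<in> closed_orthant" and h: "h \<longlonglongrightarrow> 0" "\<And>n::nat. 0 < h n"
  shows "(\<lambda>n. grid_point (h n) (grid_index (h n) x)) \<longlonglongrightarrow> x"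
proof (rule vec_tendstoI)
  fix i
  show "(\<lambda>n. grid_point (h n) (grid_index (h n) x) $ i) \<longlonglongrightarrow> x $ i"
  proof (rule tendsto_sandwich)
    show "(\<lambda>n. x $ i - h n) \<longlonglongrightarrow> x $ i"
      using tendsto_diff[OF tendsto_const h(1)] by simp
    show "\<forall>\<^sub>F n in sequentially. x $ i - h n \<le> grid_point (h n) (grid_index (h n) x) $ i"
      using grid_index_bounds(2)[OF h(2) x, where i = i] by (simp add: less_imp_le algebra_simps)
    show "\<forall>\<^sub>F n in sequentially. grid_point (h n) (grid_index (h n) x) $ i \<le> x $ i"
      using grid_index_bounds(1)[OF h(2) x, where i = i] by simp
  qed auto
qed

text \<open>Guarantees that maxima over the grid points of a ball are attained, also for
  discontinuous functions such as numerical solutions.\<close>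

lemma finite_grid_bounded:
  fixes S :: "(real^'n) set"
  assumes "0 < h" "bounded S"
  shows "finite {k. grid_point h k \<in> S}"
proof -
  obtain B where B: "\<And>x. x \<in> S \<Longrightarrow> norm x \<le> B"
    using assms(2) by (auto simp: bounded_iff)
  have "k \<in> PiE UNIV (\<lambda>_. {..nat \<lfloor>B / h\<rfloor>})" if "grid_point h k \<in> S" for k
  proof -
    have "k i \<le> nat \<lfloor>B / h\<rfloor>" for i
    proof -
      have "h * real (k i) \<le> B"
        using component_le_norm_cart[of "grid_point h k" i] B[OF that] assms(1) by simp
      then have "real (k i) \<le> B / h"
        using assms(1) by (simp add: field_simps)
      then show ?thesis by linarith
    qed
    then show ?thesis by auto
  qed
  then have "{k. grid_point h k \<in> S} \<subseteq> PiE UNIV (\<lambda>_. {..nat \<lfloor>B / h\<rfloor>})"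
    by blast
  then show ?thesis
    by (rule finite_subset) (auto intro!: finite_PiE)
qed

text \<open>A maximizer beats the rounding of \<open>x\<close> to the grid, at which the value tends
  to \<open>W x\<close>; the quadratic gap in \<open>max\<close> then forces it towards
  \<open>x\<close>.\<close>

lemma grid_maximizers_tendsto:
  fixes x :: "real^'n"
  assumes x: "x \<in> closed_orthant" and r: "0 < r" and h: "h \<longlonglongrightarrow> 0" "\<And>n::nat. 0 < h n"
    and W: "continuous_on closed_orthant W" "uniform_limit closed_orthant w W sequentially"
    and max: "\<And>y. y \<in> cball x r \<inter> closed_orthant \<Longrightarrow> W y \<le> W x - (norm (y - x))\<^sup>2"
  obtains k where "(\<lambda>n. grid_point (h n) (k n)) \<longlonglongrightarrow> x"
    "\<forall>\<^sub>F n in sequentially. \<forall>l. grid_point (h n) l \<in> cball x r \<longrightarrow>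
      w n (grid_point (h n) l) \<le> w n (grid_point (h n) (k n))"
proof -
  define G where "G n = {k. grid_point (h n) k \<in> cball x r}" for n
  define c where "c n = grid_index (h n) x" for n
  have fin: "finite (G n)" for n
    unfolding G_def using h(2) by (intro finite_grid_bounded) auto
  \<comment> \<open>The premise \<open>G n \<noteq> {}\<close> allows for coarse grids without a
    point in the ball.\<close>
  have "\<exists>k. G n \<noteq> {} \<longrightarrow> k \<in> G n \<and> (\<forall>l\<in>G n. w n (grid_point (h n) l) \<le> w n (grid_point (h n) k))" for n
  proof (cases "G n = {}")
    case False
    have "Max ((\<lambda>l. w n (grid_point (h n) l)) ` G n) \<in> (\<lambda>l. w n (grid_point (h n) l)) ` G n"
      using fin False by (intro Max_in) auto
    then obtain k where k: "k \<in> G n"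
      "Max ((\<lambda>l. w n (grid_point (h n) l)) ` G n) = w n (grid_point (h n) k)"
      by blast
    have "w n (grid_point (h n) l) \<le> w n (grid_point (h n) k)" if "l \<in> G n" for l
      unfolding k(2)[symmetric] using fin that by (intro Max_ge) auto
    then show ?thesis using k(1) by blast
  qed auto
  then obtain k where k: "\<And>n. G n \<noteq> {} \<Longrightarrow> k n \<in> G n"
    "\<And>n l. l \<in> G n \<Longrightarrow> w n (grid_point (h n) l) \<le> w n (grid_point (h n) (k n))"
    by (metis empty_iff)
  have c_lim: "(\<lambda>n. grid_point (h n) (c n)) \<longlonglongrightarrow> x"
    unfolding c_def using grid_index_tendsto[OF x h] .
  have c_in: "\<forall>\<^sub>F n in sequentially. c n \<in> G n"
    using tendstoD[OF c_lim r] unfolding G_def by eventually_elim (simp add: dist_commute less_imp_le)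
  have orth: "(grid_point (h n) l :: real^'n) \<in> closed_orthant" for n l
    using h(2)[of n] by (simp add: closed_orthant_def)
  have Wc: "(\<lambda>n. W (grid_point (h n) (c n))) \<longlonglongrightarrow> W x"
    using orth by (intro continuous_on_tendsto_compose[OF W(1) c_lim x]) auto
  have "(\<lambda>n. grid_point (h n) (k n)) \<longlonglongrightarrow> x"
  proof (rule tendstoI)
    fix e :: real
    assume e: "0 < e"
    \<comment> \<open>Three errors occur below: \<open>w n\<close> against \<open>W\<close> at the
      maximizer and at \<open>?c\<close>, and \<open>W ?c\<close> against \<open>W x\<close>.
      Together they stay below three quarters of \<open>e\<^sup>2\<close>.\<close>
    then have e4: "0 < e\<^sup>2 / 4" by simp
    show "\<forall>\<^sub>F n in sequentially. dist (grid_point (h n) (k n)) x < e"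
      using tendstoD[OF Wc e4] uniform_limitD[OF W(2) e4] c_in
    proof eventually_elim
      case (elim n)
      let ?z = "grid_point (h n) (k n)" and ?c = "grid_point (h n) (c n)"
      have "\<bar>w n ?z - W ?z\<bar> < e\<^sup>2 / 4" "\<bar>w n ?c - W ?c\<bar> < e\<^sup>2 / 4" "\<bar>W ?c - W x\<bar> < e\<^sup>2 / 4"
        using elim orth by (auto simp: dist_real_def)
      moreover have "w n ?c \<le> w n ?z"
        using k(2) elim by blast
      moreover have "W ?z \<le> W x - (norm (?z - x))\<^sup>2"
        using k(1)[of n] elim orth by (intro max) (auto simp: G_def)
      ultimately have "(norm (?z - x))\<^sup>2 < e\<^sup>2"
        using e4 by linarith
      then show "dist ?z x < e"
        using e by (simp add: dist_norm power2_less_imp_less)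
    qed
  qed
  then show thesis
    by (rule that) (use k(2) in \<open>auto simp: G_def\<close>)
qed

lemma open_orthant_open: "open (open_orthant :: (real^'n) set)"
proof -
  have "open_orthant = (\<Inter>i\<in>UNIV. {x :: real^'n. 0 < x $ i})"
    by (auto simp: open_orthant_def)
  also have "open \<dots>"
    by (intro open_INT ballI) (auto simp: open_halfspace_component_gt_cart)
  finally show ?thesis .
qed

lemma open_orthant_subset: "open_orthant \<subseteq> closed_orthant"
  by (auto simp: open_orthant_def closed_orthant_def less_imp_le)

(* The sign s = 1 serves the subsolution test (touching from above), s = -1 the supersolution
   test; the perturbation by the squared distance makes the touching strict. *)
lemma grid_touching:
  fixes x :: "real^'n" and s :: real
  assumes s: "s * s = 1" and x: "x \<in> open_orthant" and h: "h \<longlonglongrightarrow> 0" "\<And>n::nat. 0 < h n"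
    and V: "continuous_on closed_orthant V" "uniform_limit closed_orthant v V sequentially"
    and \<phi>: "C1_function \<phi>"
    and touch: "\<forall>\<^sub>F y in nhds x. s * (V y - \<phi> y) \<le> s * (V x - \<phi> x)"
  obtains k q where "(\<lambda>n. grid_point (h n) (k n)) \<longlonglongrightarrow> x"
    "\<And>i. (\<lambda>n. q n i) \<longlonglongrightarrow> partial_deriv i \<phi> x"
    "\<forall>\<^sub>F n in sequentially. \<forall>i. 0 < k n i"
    "\<forall>\<^sub>F n in sequentially. \<forall>i. s * q n i \<le>
      s * ((v n (grid_point (h n) (k n)) - v n (grid_point (h n) ((k n)(i := k n i - 1)))) / h n)"
proof -
  obtain r where r: "0 < r" "\<And>y. y \<in> cball x r \<Longrightarrow> s * (V y - \<phi> y) \<le> s * (V x - \<phi> x)"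
  proof -
    obtain e where e: "0 < e" "\<And>y. dist y x < e \<Longrightarrow> s * (V y - \<phi> y) \<le> s * (V x - \<phi> x)"
      using touch unfolding eventually_nhds_metric by blast
    then show thesis
      by (intro that[of "e / 2"]) (auto simp: dist_commute)
  qed
  have \<phi>_cont: "continuous_on A \<phi>" for A
    using \<phi> by (auto simp: C1_function_def intro!: continuous_at_imp_continuous_on differentiable_imp_continuous_within)
  define W where "W y = s * (V y - \<phi> y) - (norm (y - x))\<^sup>2" for y
  define w where "w n y = s * (v n y - \<phi> y) - (norm (y - x))\<^sup>2" for n y
  have W_cont: "continuous_on closed_orthant W"
    unfolding W_def by (intro continuous_intros V \<phi>_cont)
  have s1: "\<bar>s\<bar> = 1"
    using s by (metis abs_mult_self_eq abs_square_eq_1 power2_eq_square)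
  have dist_eq: "dist (w n y) (W y) = dist (v n y) (V y)" for n y
  proof -
    have "w n y - W y = s * (v n y - V y)"
      by (simp add: w_def W_def algebra_simps)
    then show ?thesis
      using s1 by (simp add: dist_real_def abs_mult)
  qed
  have W_lim: "uniform_limit closed_orthant w W sequentially"
    using V(2) unfolding uniform_limit_iff dist_eq .
  obtain k where z_lim: "(\<lambda>n. grid_point (h n) (k n)) \<longlonglongrightarrow> x"
    and kmax: "\<forall>\<^sub>F n in sequentially. \<forall>l. grid_point (h n) l \<in> cball x r \<longrightarrow>
      w n (grid_point (h n) l) \<le> w n (grid_point (h n) (k n))"
  proof (rule grid_maximizers_tendsto[OF _ r(1) h W_cont W_lim])
    show "x \<in> closed_orthant" using x open_orthant_subset by blast
    show "W y \<le> W x - (norm (y - x))\<^sup>2" if "y \<in> cball x r \<inter> closed_orthant" for y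
      using r(2)[of y] that by (simp add: W_def)
  qed blast
  define z where "z n = grid_point (h n) (k n)" for n
  have z: "z \<longlonglongrightarrow> x"
    using z_lim unfolding z_def .
  \<comment> \<open>The backward difference quotient of the perturbed test function: the added term
    is \<open>s\<close> times that of the squared distance to \<open>x\<close>, and it tends to
    0.\<close>
  define q where "q n i = (\<phi> (z n) - \<phi> (z n - h n *\<^sub>R axis i 1)) / h n + s * (2 * (z n - x) $ i - h n)"
    for n i
  have q_lim: "(\<lambda>n. q n i) \<longlonglongrightarrow> partial_deriv i \<phi> x" for i
  proof -
    have "(\<lambda>n. q n i) \<longlonglongrightarrow> partial_deriv i \<phi> x + s * (2 * (x - x) $ i - 0)"
      unfolding q_def by (intro tendsto_intros z h(1) partial_difference_quotient[OF \<phi> z h])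
    then show ?thesis by simp
  qed
  have pos: "\<forall>\<^sub>F n in sequentially. \<forall>i. 0 < k n i"
  proof -
    have "\<forall>\<^sub>F n in sequentially. z n \<in> open_orthant"
      using topological_tendstoD[OF z open_orthant_open x] .
    then show ?thesis
      by eventually_elim (use h(2) in \<open>auto simp: z_def open_orthant_def zero_less_mult_iff\<close>)
  qed
  have near: "\<forall>\<^sub>F n in sequentially. \<forall>i. z n - h n *\<^sub>R axis i 1 \<in> cball x r"
  proof (intro eventually_all_finite)
    fix i
    have "(\<lambda>n. z n - h n *\<^sub>R axis i 1) \<longlonglongrightarrow> x - 0 *\<^sub>R axis i 1"
      by (intro tendsto_intros z h)
    then have "(\<lambda>n. z n - h n *\<^sub>R axis i 1) \<longlonglongrightarrow> x" by simp
    from tendstoD[OF this r(1)]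
    show "\<forall>\<^sub>F n in sequentially. z n - h n *\<^sub>R axis i 1 \<in> cball x r"
      by eventually_elim (simp add: dist_commute less_imp_le)
  qed
  have "\<forall>\<^sub>F n in sequentially. \<forall>i. s * q n i \<le>
      s * ((v n (grid_point (h n) (k n)) - v n (grid_point (h n) ((k n)(i := k n i - 1)))) / h n)"
    using kmax pos near
  proof eventually_elim
    case (elim n)
    show ?case
    proof
      fix i
      define z' where "z' = z n - h n *\<^sub>R axis i 1"
      have z': "grid_point (h n) ((k n)(i := k n i - 1)) = z'"
        unfolding z'_def z_def using elim(2) by (simp add: grid_point_minus_axis)
      \<comment> \<open>The predecessor \<open>z'\<close> is a grid point in the ball, so it
        competes with the maximizer \<open>z n\<close>.\<close>
      have "w n z' \<le> w n (z n)"
        using elim(1,3) z' unfolding z'_def z_def by metis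
      moreover have "(norm (z n - x))\<^sup>2 - (norm (z' - x))\<^sup>2 = h n * (2 * (z n - x) $ i - h n)"
        unfolding z'_def power2_norm_eq_inner
        by (simp add: algebra_simps inner_diff_left inner_diff_right inner_axis inner_axis' inner_commute)
      ultimately have "s * (\<phi> (z n) - \<phi> z') + h n * (2 * (z n - x) $ i - h n) \<le> s * (v n (z n) - v n z')"
        unfolding w_def by (simp add: algebra_simps)
      moreover have "s * q n i * h n = s * (\<phi> (z n) - \<phi> z') + (s * s) * (h n * (2 * (z n - x) $ i - h n))"
        unfolding q_def z'_def using h(2)[of n] by (simp add: field_simps)
      ultimately have "s * q n i * h n \<le> s * (v n (z n) - v n z')"
        using s by simp
      then show "s * q n i \<le>
        s * ((v n (grid_point (h n) (k n)) - v n (grid_point (h n) ((k n)(i := k n i - 1)))) / h n)"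
        unfolding z' z_def[symmetric] using h(2)[of n] by (simp add: field_simps)
    qed
  qed
  with z_lim q_lim pos show thesis by (rule that)
qed

section \<open>Envelopes and the viscosity inequalities\<close>

lemma le_usc_envelope:
  assumes z: "z \<longlonglongrightarrow> x" and a: "a \<longlonglongrightarrow> A" and le: "\<forall>\<^sub>F n in sequentially. a n \<le> f (z n)"
  shows "ereal A \<le> usc_envelope f x"
proof (rule ccontr)
  assume "\<not> ?thesis"
  then obtain c where c: "usc_envelope f x < ereal c" "ereal c < ereal A"
    using ereal_dense2 by (metis not_le)
  have "\<forall>\<^sub>F y in nhds x. ereal (f y) < ereal c"
    using Limsup_lessD c(1) unfolding usc_envelope_def by blast
  then have "\<forall>\<^sub>F n in sequentially. ereal (f (z n)) < ereal c"
    using z by (rule eventually_compose_filterlim)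
  moreover have "\<forall>\<^sub>F n in sequentially. c < a n"
    using order_tendstoD(1)[OF a] c(2) by simp
  ultimately have "\<forall>\<^sub>F n in sequentially. False"
    using le by eventually_elim simp
  then show False by simp
qed

lemma lsc_envelope_le:
  assumes z: "z \<longlonglongrightarrow> x" and a: "a \<longlonglongrightarrow> A" and le: "\<forall>\<^sub>F n in sequentially. f (z n) \<le> a n"
  shows "lsc_envelope f x \<le> ereal A"
proof (rule ccontr)
  assume "\<not> ?thesis"
  then obtain c where c: "ereal c < lsc_envelope f x" "ereal A < ereal c"
    using ereal_dense2 by (metis not_le)
  have "\<forall>\<^sub>F y in nhds x. ereal c < ereal (f y)"
    using less_LiminfD c(1) unfolding lsc_envelope_def by blast
  then have "\<forall>\<^sub>F n in sequentially. ereal c < ereal (f (z n))"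
    using z by (rule eventually_compose_filterlim)
  moreover have "\<forall>\<^sub>F n in sequentially. a n < c"
    using order_tendstoD(2)[OF a] c(2) by simp
  ultimately have "\<forall>\<^sub>F n in sequentially. False"
    using le by eventually_elim simp
  then show False by simp
qed

text \<open>\<open>V\<close> does not decrease along \<open>axis i 1\<close>, and near
  \<open>x\<close> the increase of \<open>\<phi>\<close> from \<open>x\<close> is at least that of
  \<open>V\<close>. This rules out negative factors in the subsolution test.\<close>

lemma touching_partial_deriv_nonneg:
  fixes x :: "real^'n"
  assumes V: "mono_on closed_orthant V" and x: "x \<in> open_orthant" and \<phi>: "C1_function \<phi>"
    and touch: "\<forall>\<^sub>F y in nhds x. V y - \<phi> y \<le> V x - \<phi> x"
  shows "0 \<le> partial_deriv i \<phi> x"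
proof -
  define h where "h n = inverse (real (Suc n))" for n
  have h: "h \<longlonglongrightarrow> 0" "\<And>n. 0 < h n"
    unfolding h_def by (rule LIMSEQ_inverse_real_of_nat) simp
  define z where "z n = x + h n *\<^sub>R axis i 1" for n
  have "z \<longlonglongrightarrow> x + 0 *\<^sub>R axis i 1"
    unfolding z_def by (intro tendsto_intros h)
  then have z: "z \<longlonglongrightarrow> x" by simp
  have "\<forall>\<^sub>F n in sequentially. 0 \<le> (\<phi> (z n) - \<phi> (z n - h n *\<^sub>R axis i 1)) / h n"
    using eventually_compose_filterlim[OF touch z]
  proof eventually_elim
    case (elim n)
    have x_orth: "x \<in> closed_orthant"
      using x open_orthant_subset by blast
    have "x \<le> z n"
      using h(2)[of n] by (simp add: z_def less_eq_vec_def axis_def)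
    moreover from this have "z n \<in> closed_orthant"
      using x_orth by (auto simp: closed_orthant_def less_eq_vec_def intro: order_trans)
    ultimately have "V x \<le> V (z n)"
      using V x_orth by (auto dest: mono_onD)
    then have "\<phi> x \<le> \<phi> (z n)"
      using elim by linarith
    then show ?case
      using h(2)[of n] by (simp add: z_def)
  qed
  with partial_difference_quotient[OF \<phi> z h] show ?thesis
    by (rule tendsto_lowerbound) simp
qed

text \<open>At the points from \<open>grid_touching\<close> the quotients of \<open>v n\<close>
  multiply to the value of \<open>f\<close>. They are compared factor by factor with quotients of
  the test function; for this the smaller factors must be nonnegative, and the two tests differ in
  where that sign comes from.\<close>

lemma numerical_limit_viscosity_solution:
  fixes f V :: "real^'n \<Rightarrow> real"
  assumes f: "\<And>x. 0 \<le> f x" and h: "h \<longlonglongrightarrow> 0"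
    and v: "\<And>n. numerical f (h n) (v n) M"
    and V: "continuous_on closed_orthant V" "uniform_limit closed_orthant v V sequentially"
      "mono_on closed_orthant V"
  shows "viscosity_solution f V"
proof -
  have h_pos: "0 < h n" for n
    using v[of n] by (rule numerical.h)
  have prod_quot: "(\<Prod>i\<in>UNIV. (v n (grid_point (h n) k) - v n (grid_point (h n) (k(i := k i - 1)))) / h n)
      = f (grid_point (h n) k)" if "\<forall>i. 0 < k i" for n k
    using numerical.on_grid(3)[OF v, of k n] that h_pos[of n] by (simp add: prod_dividef)
  have sub: "ereal (\<Prod>i\<in>UNIV. partial_deriv i \<phi> x) \<le> usc_envelope f x"
    if x: "x \<in> open_orthant" and \<phi>: "C1_function \<phi>"
      and touch: "\<forall>\<^sub>F y in nhds x. V y - \<phi> y \<le> V x - \<phi> x" for x \<phi>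
  proof (cases "\<forall>i. 0 < partial_deriv i \<phi> x")
    \<comment> \<open>A vanishing partial derivative makes the product zero, and the upper envelope
      is nonnegative because \<open>f\<close> is: the constant sequence \<open>x\<close> shows
      this.\<close>
    case False
    then obtain i where "partial_deriv i \<phi> x = 0"
      using touching_partial_deriv_nonneg[OF V(3) x \<phi> touch] by (metis less_eq_real_def)
    then have "(\<Prod>i\<in>UNIV. partial_deriv i \<phi> x) = 0"
      by auto
    moreover have "ereal 0 \<le> usc_envelope f x"
      using f by (intro le_usc_envelope[of "\<lambda>_. x" _ "\<lambda>_. 0"]) auto
    ultimately show ?thesis by metis
  next
    case True
    have touch': "\<forall>\<^sub>F y in nhds x. 1 * (V y - \<phi> y) \<le> 1 * (V x - \<phi> x)"
      using touch by simp
    obtain k q where z: "(\<lambda>n. grid_point (h n) (k n)) \<longlonglongrightarrow> x"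
      and q: "\<And>i. (\<lambda>n. q n i) \<longlonglongrightarrow> partial_deriv i \<phi> x"
      and k: "\<forall>\<^sub>F n in sequentially. \<forall>i. 0 < k n i"
      and le: "\<forall>\<^sub>F n in sequentially. \<forall>i. 1 * q n i \<le>
        1 * ((v n (grid_point (h n) (k n)) - v n (grid_point (h n) ((k n)(i := k n i - 1)))) / h n)"
      by (rule grid_touching[OF _ x h h_pos V(1,2) \<phi> touch']) auto
    \<comment> \<open>The limits of the \<open>q n i\<close> are positive, so the inequalities may
      be multiplied for large \<open>n\<close>.\<close>
    have "\<forall>\<^sub>F n in sequentially. \<forall>i. 0 < q n i"
      using order_tendstoD(1)[OF q] True by (intro eventually_all_finite) auto
    then have "\<forall>\<^sub>F n in sequentially. (\<Prod>i\<in>UNIV. q n i) \<le> f (grid_point (h n) (k n))"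
      using k le
    proof eventually_elim
      case (elim n)
      show ?case
        unfolding prod_quot[OF elim(2), symmetric]
        using elim(1,3) by (intro prod_mono) (auto simp: less_imp_le)
    qed
    with z q show ?thesis
      by (intro le_usc_envelope[of _ x "\<lambda>n. \<Prod>i\<in>UNIV. q n i"] tendsto_prod) auto
  qed
  have super: "lsc_envelope f x \<le> ereal (\<Prod>i\<in>UNIV. partial_deriv i \<phi> x)"
    if x: "x \<in> open_orthant" and \<phi>: "C1_function \<phi>"
      and touch: "\<forall>\<^sub>F y in nhds x. V x - \<phi> x \<le> V y - \<phi> y" for x \<phi>
  proof -
    have touch': "\<forall>\<^sub>F y in nhds x. - 1 * (V y - \<phi> y) \<le> - 1 * (V x - \<phi> x)"
      using touch by eventually_elim simp
    obtain k q where z: "(\<lambda>n. grid_point (h n) (k n)) \<longlonglongrightarrow> x"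
      and q: "\<And>i. (\<lambda>n. q n i) \<longlonglongrightarrow> partial_deriv i \<phi> x"
      and k: "\<forall>\<^sub>F n in sequentially. \<forall>i. 0 < k n i"
      and le: "\<forall>\<^sub>F n in sequentially. \<forall>i. - 1 * q n i \<le>
        - 1 * ((v n (grid_point (h n) (k n)) - v n (grid_point (h n) ((k n)(i := k n i - 1)))) / h n)"
      by (rule grid_touching[OF _ x h h_pos V(1,2) \<phi> touch']) auto
    have "\<forall>\<^sub>F n in sequentially. f (grid_point (h n) (k n)) \<le> (\<Prod>i\<in>UNIV. q n i)"
      using k le
    proof eventually_elim
      case (elim n)
      show ?case
        unfolding prod_quot[OF elim(1), symmetric]
      \<comment> \<open>Here the smaller factors are the quotients of \<open>v n\<close>, which are
        nonnegative by the monotonicity built into the scheme.\<close>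
      proof (intro prod_mono conjI)
        fix i
        show "0 \<le> (v n (grid_point (h n) (k n)) - v n (grid_point (h n) ((k n)(i := k n i - 1)))) / h n"
          using numerical.on_grid(2)[OF v, of "k n" n i] elim(1) h_pos[of n] by simp
        show "(v n (grid_point (h n) (k n)) - v n (grid_point (h n) ((k n)(i := k n i - 1)))) / h n \<le> q n i"
          using elim(2)[rule_format, of i] by linarith
      qed
    qed
    with z q show ?thesis
      by (intro lsc_envelope_le[of _ x "\<lambda>n. \<Prod>i\<in>UNIV. q n i"] tendsto_prod) auto
  qed
  show ?thesis
    unfolding viscosity_solution_def using V(1) sub super by blast
qed

section \<open>Compactness and convergence\<close>

lemma truncate_in_cbox:
  fixes x :: "real^'n"
  assumes "x \<in> closed_orthant"
  shows "(\<chi> i. min (x $ i) 1) \<in> cbox 0 1"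
  using assms by (auto simp: closed_orthant_def mem_box_cart)

lemma cbox_subset_closed_orthant: "cbox 0 1 \<subseteq> (closed_orthant :: (real^'n) set)"
  by (auto simp: closed_orthant_def mem_box_cart)

lemma frontier_open_orthant_subset:
  fixes x :: "real^'n"
  assumes "x \<in> frontier open_orthant"
  shows "x \<in> closed_orthant \<and> (\<exists>i. x $ i = 0)"
proof -
  have "closed_orthant = (\<Inter>i\<in>UNIV. {x :: real^'n. 0 \<le> x $ i})"
    by (auto simp: closed_orthant_def)
  also have "closed \<dots>"
    by (intro closed_INT ballI) (auto simp: closed_halfspace_component_ge_cart)
  finally have "closure open_orthant \<subseteq> (closed_orthant :: (real^'n) set)"
    using open_orthant_subset by (intro closure_minimal)
  then have "x \<in> closed_orthant" "x \<notin> open_orthant"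
    using assms by (auto simp: frontier_def interior_open[OF open_orthant_open])
  then show ?thesis
    by (force simp: closed_orthant_def open_orthant_def not_less intro: antisym)
qed

text \<open>A finite upper envelope bounds \<open>f\<close> near each point, and finitely many such
  neighbourhoods cover \<open>K\<close>. Applied to the unit cube, this yields the constant
  \<open>M\<close>.\<close>

lemma locally_bounded_above_imp_bounded_above:
  fixes f :: "real^'n \<Rightarrow> real"
  assumes "compact K" and usc: "\<And>x. usc_envelope f x < \<infinity>"
  shows "\<exists>M. \<forall>x\<in>K. f x \<le> M"
proof -
  have "\<exists>c S. open S \<and> x \<in> S \<and> (\<forall>y\<in>S. f y \<le> c)" for x
  proof -
    obtain c where "usc_envelope f x < ereal c"
      using usc[of x] less_PInf_Ex_of_nat by (metis ereal_dense2)
    then have "\<forall>\<^sub>F y in nhds x. ereal (f y) < ereal c"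
      using Limsup_lessD unfolding usc_envelope_def by blast
    then show ?thesis
      unfolding eventually_nhds by (metis ereal_less_eq(3) less_imp_le)
  qed
  then obtain c S where S: "\<And>x. open (S x)" "\<And>x. x \<in> S x" "\<And>x y. y \<in> S x \<Longrightarrow> f y \<le> c x"
    by metis
  obtain D where D: "D \<subseteq> K" "finite D" "K \<subseteq> (\<Union>x\<in>D. S x)"
    using compactE_image[OF assms(1), of K S] S by blast
  \<comment> \<open>The sum of absolute values replaces a maximum over \<open>D\<close> and makes
    sense for empty \<open>D\<close> too.\<close>
  have "f x \<le> (\<Sum>y\<in>D. \<bar>c y\<bar>)" if x: "x \<in> K" for x
  proof -
    obtain y where y: "y \<in> D" "x \<in> S y" using D x by blast
    have "f x \<le> \<bar>c y\<bar>" using S(3)[OF y(2)] by linarith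
    also have "\<dots> \<le> (\<Sum>y\<in>D. \<bar>c y\<bar>)"
      using D y by (intro member_le_sum) auto
    finally show ?thesis .
  qed
  then show ?thesis by blast
qed

section \<open>Compactness up to a vanishing error\<close>

lemma uniform_limit_close:
  fixes f g :: "nat \<Rightarrow> 'a \<Rightarrow> real"
  assumes g: "uniform_limit S g l sequentially" and c: "c \<longlonglongrightarrow> 0"
    and fg: "\<And>n x. x \<in> S \<Longrightarrow> \<bar>f n x - g n x\<bar> \<le> c n"
  shows "uniform_limit S f l sequentially"
proof (rule uniform_limitI)
  fix e :: real
  assume "0 < e"
  then have e: "0 < e / 2" by simp
  show "\<forall>\<^sub>F n in sequentially. \<forall>x\<in>S. dist (f n x) (l x) < e"
    using uniform_limitD[OF g e] order_tendstoD(2)[OF c e]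
  proof eventually_elim
    case (elim n)
    show ?case
    proof
      fix x assume x: "x \<in> S"
      have "\<bar>g n x - l x\<bar> < e / 2"
        using elim(1) x by (simp add: dist_real_def)
      then show "dist (f n x) (l x) < e"
        using fg[OF x, of n] elim(2) unfolding dist_real_def by linarith
    qed
  qed
qed

(* The functions need only be equicontinuous up to an error c n tending to 0; their
   sup-convolutions with the modulus are genuinely equicontinuous and c n-close to them. *)
lemma Arzela_Ascoli_asymptotic:
  fixes v :: "nat \<Rightarrow> 'a::euclidean_space \<Rightarrow> real"
  assumes S: "compact S"
    and \<omega>: "\<And>s t. 0 \<le> s \<Longrightarrow> 0 \<le> t \<Longrightarrow> \<omega> (s + t) \<le> \<omega> s + \<omega> t" "mono \<omega>" "isCont \<omega> 0" "\<omega> 0 = (0::real)"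
    and bound: "\<And>n x. x \<in> S \<Longrightarrow> \<bar>v n x\<bar> \<le> B"
    and modulus: "\<And>n x y. x \<in> S \<Longrightarrow> y \<in> S \<Longrightarrow> v n y \<le> v n x + \<omega> (norm (x - y)) + c n"
    and c: "c \<longlonglongrightarrow> 0"
  obtains g r where "continuous_on S g" "strict_mono r" "uniform_limit S (\<lambda>n. v (r n)) g sequentially"
proof (cases "S = {}")
  case True
  then show thesis using that[of _ id] by (simp add: uniform_limit_iff strict_mono_id)
next
  case False
  define w where "w n x = (SUP y\<in>S. v n y - \<omega> (norm (x - y)))" for n x
  have \<omega>_nonneg: "0 \<le> \<omega> t" if "0 \<le> t" for t
    using monoD[OF \<omega>(2) that] \<omega>(4) by simp
  have bdd: "bdd_above ((\<lambda>y. v n y - \<omega> (norm (x - y))) ` S)" for n x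
  proof (rule bdd_aboveI2)
    fix y assume "y \<in> S"
    then show "v n y - \<omega> (norm (x - y)) \<le> B"
      using bound[of y n] \<omega>_nonneg[of "norm (x - y)"] by simp
  qed
  \<comment> \<open>The choice \<open>y = x\<close> in the supremum gives this bound; the opposite
    one is the assumed modulus with its error \<open>c n\<close>.\<close>
  have w_ge: "v n x \<le> w n x" if "x \<in> S" for n x
    unfolding w_def by (rule cSUP_upper2[OF bdd that]) (simp add: \<omega>)
  have w_le: "w n x \<le> v n x + c n" if "x \<in> S" for n x
    unfolding w_def
  proof (rule cSUP_least[OF False])
    fix y assume "y \<in> S"
    then show "v n y - \<omega> (norm (x - y)) \<le> v n x + c n"
      using modulus[OF that, of y n] by linarith
  qed
  have w_B: "\<bar>w n x\<bar> \<le> B" if "x \<in> S" for n x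
  proof (rule abs_leI)
    show "w n x \<le> B"
      unfolding w_def
    proof (rule cSUP_least[OF False])
      fix y assume "y \<in> S"
      then show "v n y - \<omega> (norm (x - y)) \<le> B"
        using bound[of y n] \<omega>_nonneg[of "norm (x - y)"] by simp
    qed
    show "- w n x \<le> B"
      using w_ge[OF that, of n] bound[OF that, of n] by linarith
  qed
  \<comment> \<open>The error \<open>c n\<close> is absent here: the triangle inequality, with
    \<open>\<omega>\<close> monotone and subadditive, compares the two suprema term by term.\<close>
  have w_mod: "w n x - w n x' \<le> \<omega> (norm (x - x'))" for n x x'
  proof -
    have "w n x \<le> w n x' + \<omega> (norm (x - x'))"
      unfolding w_def[of n x]
    proof (rule cSUP_least[OF False])
      fix y assume y: "y \<in> S"
      have "norm (x' - y) \<le> norm (x - x') + norm (x - y)"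
        using norm_triangle_ineq[of "x' - x" "x - y"] by (simp add: norm_minus_commute)
      then have "\<omega> (norm (x' - y)) \<le> \<omega> (norm (x - x') + norm (x - y))"
        using \<omega>(2) by (rule monoD[rotated])
      also have "\<dots> \<le> \<omega> (norm (x - x')) + \<omega> (norm (x - y))"
        by (intro \<omega>) auto
      finally have "\<omega> (norm (x' - y)) \<le> \<omega> (norm (x - x')) + \<omega> (norm (x - y))" .
      moreover have "v n y - \<omega> (norm (x' - y)) \<le> w n x'"
        unfolding w_def by (rule cSUP_upper[OF y bdd])
      ultimately show "v n y - \<omega> (norm (x - y)) \<le> w n x' + \<omega> (norm (x - x'))"
        by linarith
    qed
    then show ?thesis by linarith
  qed
  have equi: "\<exists>d. 0 < d \<and> (\<forall>n y. y \<in> S \<and> norm (x - y) < d \<longrightarrow> norm (w n x - w n y) < e)"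
    if "0 < e" for x e
  proof -
    obtain d where d: "0 < d" "\<And>t. dist t 0 < d \<Longrightarrow> dist (\<omega> t) (\<omega> 0) < e"
      using \<omega>(3) \<open>0 < e\<close> unfolding continuous_at_eps_delta by (auto simp: dist_real_def)
    have "norm (w n x - w n y) < e" if "norm (x - y) < d" for n y
    proof -
      have "\<omega> (norm (x - y)) < e"
        using d(2)[of "norm (x - y)"] that \<omega>(4) by (simp add: dist_real_def)
      then show ?thesis
        using w_mod[of n x y] w_mod[of n y x] by (simp add: norm_minus_commute abs_less_iff)
    qed
    with d(1) show ?thesis by blast
  qed
  obtain g and r :: "nat \<Rightarrow> nat" where g: "continuous_on S g" and r: "strict_mono r"
    and lim: "\<And>e. 0 < e \<Longrightarrow> \<exists>N. \<forall>n x. n \<ge> N \<and> x \<in> S \<longrightarrow> norm (w (r n) x - g x) < e"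
    by (rule Arzela_Ascoli[OF S, of w B]) (use w_B equi in auto)
  have "uniform_limit S (\<lambda>n. w (r n)) g sequentially"
    unfolding uniform_limit_sequentially_iff dist_norm using lim by blast
  moreover have "(\<lambda>n. c (r n)) \<longlonglongrightarrow> 0"
    using LIMSEQ_subseq_LIMSEQ[OF c r] by (simp add: o_def)
  ultimately have "uniform_limit S (\<lambda>n. v (r n)) g sequentially"
  proof (rule uniform_limit_close)
    show "\<bar>v (r n) x - w (r n) x\<bar> \<le> c (r n)" if "x \<in> S" for n x
      using w_ge[OF that, of "r n"] w_le[OF that, of "r n"] by linarith
  qed
  with g r show thesis by (rule that)
qed

section \<open>Identification of the limits and convergence\<close>

lemma numerical_limit_pareto_solution:
  fixes f V :: "real^'n \<Rightarrow> real"
  assumes f: "\<And>x. 0 \<le> f x" and h: "h \<longlonglongrightarrow> 0"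
    and v: "\<And>n. numerical f (h n) (v n) M"
    and V: "continuous_on closed_orthant V" "uniform_limit closed_orthant v V sequentially"
  shows "pareto_solution f V"
proof -
  \<comment> \<open>Monotonicity, boundary values and truncation relate at most two values at a
    time, so pointwise convergence preserves them.\<close>
  have lim: "(\<lambda>n. v n x) \<longlonglongrightarrow> V x" if "x \<in> closed_orthant" for x
    using tendsto_uniform_limitI[OF V(2) that] .
  have mono: "mono_on closed_orthant V"
  proof (rule mono_onI)
    fix x y :: "real^'n"
    assume xy: "x \<in> closed_orthant" "y \<in> closed_orthant" "x \<le> y"
    then have "v n x \<le> v n y" for n
      using numerical.v_mono[OF v] by blast
    then show "V x \<le> V y"
      by (intro LIMSEQ_le[OF lim[OF xy(1)] lim[OF xy(2)]]) auto
  qed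
  moreover have "V x = 0" if x_front: "x \<in> frontier open_orthant" for x
  proof -
    obtain i where x: "x \<in> closed_orthant" "x $ i = 0"
      using frontier_open_orthant_subset[OF x_front] by blast
    then have "v n x = 0" for n
      using numerical.v_zero[OF v] by blast
    then show ?thesis
      using lim[OF x(1)] by (simp add: LIMSEQ_const_iff)
  qed
  moreover have "V x = V (\<chi> i. min (x $ i) 1)" if x: "x \<in> closed_orthant" for x
  proof -
    have "v n (\<chi> i. min (x $ i) 1) = v n x" for n
      using numerical.v_truncate[OF v x] .
    moreover have "(\<chi> i. min (x $ i) 1) \<in> closed_orthant"
      using truncate_in_cbox[OF x] cbox_subset_closed_orthant by blast
    ultimately have "(\<lambda>n. v n x) \<longlonglongrightarrow> V (\<chi> i. min (x $ i) 1)"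
      using lim[of "\<chi> i. min (x $ i) 1"] by simp
    then show ?thesis
      using lim[OF x] by (rule LIMSEQ_unique[rotated])
  qed
  ultimately show ?thesis
    unfolding pareto_solution_def
    using numerical_limit_viscosity_solution[OF f h v V mono] by blast
qed

text \<open>Compactness is available on the unit cube; truncation at 1, which does not change the
  values of \<open>v n\<close>, carries the limit to the unbounded orthant without loss of
  uniformity.\<close>

lemma numerical_subsequence:
  fixes f :: "real^'n \<Rightarrow> real"
  assumes h: "h \<longlonglongrightarrow> 0" "\<And>n. h n \<le> 1"
    and v: "\<And>n. numerical f (h n) (v n) M"
  obtains V r where "strict_mono r" "continuous_on closed_orthant V"
    "uniform_limit closed_orthant (\<lambda>n. v (r n)) V sequentially"
proof -
  let ?d = "CARD('n)"
  define C where "C = (real ?d)\<^sup>2 * root ?d M"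
  have C: "0 \<le> C"
    using numerical.M_nonneg[OF v] by (simp add: C_def)
  obtain R where R: "\<And>x. x \<in> cbox 0 (1 :: real^'n) \<Longrightarrow> norm x \<le> R"
    using bounded_cbox[of 0 "1 :: real^'n"] by (auto simp: bounded_iff)
  have modulus: "v n y \<le> v n x + C * root ?d (norm (x - y)) + C * root ?d (h n)"
    if "x \<in> cbox 0 1" "y \<in> cbox 0 1" for n x y
    using numerical.v_modulus[OF v that, of n] by (simp add: C_def algebra_simps)
  \<comment> \<open>Comparison with the origin, where \<open>v n\<close> vanishes: \<open>R\<close>
    bounds the norm on the cube, and the extra \<open>C\<close> absorbs the rounding term since
    \<open>h n \<le> 1\<close>.\<close>
  have bound: "\<bar>v n x\<bar> \<le> C * root ?d R + C" if x: "x \<in> cbox 0 1" for n x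
  proof -
    have zero: "(0 :: real^'n) \<in> cbox 0 1"
      by (simp add: mem_box_cart)
    then have "v n 0 = 0"
      using numerical.v_zero[OF v] cbox_subset_closed_orthant by (metis subsetD zero_index)
    moreover have "C * root ?d (norm x) \<le> C * root ?d R" "C * root ?d (h n) \<le> C * 1"
      using C R[OF x] h(2)[of n] by (intro mult_left_mono; simp)+
    moreover have "0 \<le> v n x"
      using numerical.v_nonneg[OF v] x cbox_subset_closed_orthant by blast
    ultimately show ?thesis
      using modulus[OF zero x, of n] by simp
  qed
  obtain g r where g: "continuous_on (cbox 0 (1 :: real^'n)) g" and r: "strict_mono r"
    and lim: "uniform_limit (cbox 0 1) (\<lambda>n. v (r n)) g sequentially"
  proof (rule Arzela_Ascoli_asymptotic[where S = "cbox 0 (1 :: real^'n)" and v = v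
        and \<omega> = "\<lambda>t. C * root ?d t" and c = "\<lambda>n. C * root ?d (h n)"])
    show "C * root ?d (s + t) \<le> C * root ?d s + C * root ?d t" if "0 \<le> s" "0 \<le> t" for s t
      using mult_left_mono[OF root_add_le[OF _ that] C, of ?d] by (simp add: algebra_simps)
    show "mono (\<lambda>t. C * root ?d t)"
      using C by (auto intro!: monoI mult_left_mono)
    show "isCont (\<lambda>t. C * root ?d t) 0"
      by (intro continuous_intros isCont_real_root)
    have "(\<lambda>n. C * root ?d (h n)) \<longlonglongrightarrow> C * root ?d 0"
      by (intro tendsto_intros h)
    then show "(\<lambda>n. C * root ?d (h n)) \<longlonglongrightarrow> 0"
      by simp
  qed (use modulus bound in auto)
  define T where "T x = (\<chi> i. min (x $ i) 1)" for x :: "real^'n"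
  have T: "T x \<in> cbox 0 1" if "x \<in> closed_orthant" for x
    unfolding T_def using truncate_in_cbox[OF that] .
  have "continuous_on closed_orthant (\<lambda>x. g (T x))"
  proof (rule continuous_on_compose2[OF g])
    show "continuous_on closed_orthant T"
      unfolding T_def by (intro continuous_intros)
  qed (use T in auto)
  moreover have "uniform_limit closed_orthant (\<lambda>n. v (r n)) (\<lambda>x. g (T x)) sequentially"
  proof (rule uniform_limitI)
    fix e :: real
    assume "0 < e"
    from uniform_limitD[OF lim this]
    show "\<forall>\<^sub>F n in sequentially. \<forall>x\<in>closed_orthant. dist (v (r n) x) (g (T x)) < e"
    proof eventually_elim
      case (elim n)
      show ?case
        using elim T numerical.v_truncate[OF v, of _ "r n"] unfolding T_def by metis
    qed
  qed
  ultimately show thesis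
    using r that by blast
qed

theorem theorem1:
  fixes f U :: "real^'n \<Rightarrow> real" and Uh :: "real \<Rightarrow> real^'n \<Rightarrow> real" and \<Omega> :: "(real^'n) set"
  assumes f_nonneg: "\<And>x. 0 \<le> f x"
    and f_usc_finite: "\<And>x. usc_envelope f x < \<infinity>"
    and \<Omega>: "open \<Omega>" "bounded \<Omega>" "\<Omega> \<subseteq> box 0 1" "lipschitz_boundary \<Omega>"
    and f_lipschitz: "\<exists>L. L-lipschitz_on \<Omega> f"
    and f_supp: "closure {x. f x \<noteq> 0} \<subseteq> closure \<Omega>"
    and U_solution: "pareto_solution f U"
    and U_unique: "\<And>V. pareto_solution f V \<Longrightarrow> \<forall>x \<in> closed_orthant. V x = U x"
    and Uh: "\<And>h. h > 0 \<Longrightarrow> numerical_solution f h (Uh h)"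
  shows "uniform_limit closed_orthant Uh U (at_right 0)"
proof (rule uniform_limitI, rule sequentially_imp_eventually_at_right[of 0 1])
  fix e :: real and h :: "nat \<Rightarrow> real"
  \<comment> \<open>Convergence from the right at 0 is tested on null sequences; taking them in the
    interval from 0 to 1 supplies the bound \<open>h n \<le> 1\<close> for the compactness
    lemma.\<close>
  assume e: "0 < e" and h: "\<And>n. 0 < h n" "\<And>n. h n < 1" "h \<longlonglongrightarrow> 0"
  have "closure \<Omega> \<subseteq> cbox 0 1"
    using \<Omega>(3) box_subset_cbox[of 0 1] by (intro closure_minimal) auto
  then have supp: "x \<in> cbox 0 1" if "f x \<noteq> 0" for x
    using that f_supp closure_subset[of "{x. f x \<noteq> 0}"] by blast
  obtain M where M: "\<And>x. x \<in> cbox 0 1 \<Longrightarrow> f x \<le> M"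
    using locally_bounded_above_imp_bounded_above[OF compact_cbox f_usc_finite] by metis
  have "0 \<le> M"
    using M[of 0] f_nonneg[of 0] by (simp add: mem_box_cart)
  have num: "numerical f (h n) (Uh (h n)) M" for n
  proof
    show "f x \<le> M" for x
      using M[of x] supp[of x] \<open>0 \<le> M\<close> by (cases "f x = 0") auto
    show "f x = 0" if "1 < x $ i" for x i
    proof (rule ccontr)
      assume "f x \<noteq> 0"
      then have "x $ i \<le> 1"
        using supp[of x] by (simp add: mem_box_cart)
      then show False using that by simp
    qed
  qed (use h Uh in auto)
  show "\<forall>\<^sub>F n in sequentially. \<forall>x\<in>closed_orthant. dist (Uh (h n) x) (U x) < e"
  \<comment> \<open>If convergence failed, some subsequence would violate the estimate at every
    index; a further subsequence converges to a limit that uniqueness identifies with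
    \<open>U\<close>.\<close>
  proof (rule ccontr)
    assume "\<not> ?thesis"
    then obtain s :: "nat \<Rightarrow> nat" where s: "strict_mono s"
      and bad: "\<And>n. \<not> (\<forall>x\<in>closed_orthant. dist (Uh (h (s n)) x) (U x) < e)"
      using not_eventually_sequentiallyD by blast
    have hs: "(\<lambda>n. h (s n)) \<longlonglongrightarrow> 0"
      using LIMSEQ_subseq_LIMSEQ[OF h(3) s] by (simp add: o_def)
    obtain V r where r: "strict_mono r" and V: "continuous_on closed_orthant V"
      "uniform_limit closed_orthant (\<lambda>n. Uh (h (s (r n)))) V sequentially"
      using numerical_subsequence[OF hs less_imp_le[OF h(2)] num] by blast
    have "(\<lambda>n. h (s (r n))) \<longlonglongrightarrow> 0"
      using LIMSEQ_subseq_LIMSEQ[OF hs r] by (simp add: o_def)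
    then have "pareto_solution f V"
      using num V by (rule numerical_limit_pareto_solution[OF f_nonneg])
    then have VU: "\<And>x. x \<in> closed_orthant \<Longrightarrow> V x = U x"
      using U_unique by blast
    have "\<forall>\<^sub>F n in sequentially. \<forall>x\<in>closed_orthant. dist (Uh (h (s (r n))) x) (U x) < e"
      using uniform_limitD[OF V(2) e] VU by simp
    then show False
      using bad by (auto dest: eventually_happens)
  qed
qed simp

end
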